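(* Let $(E,d)$ be a metric space which satisfies the parallelogram inequality (PI) and such that $d(x,y)=2\,\mathrm{rad}(\{x,y\})$ for all $x,y\in E$. Let $(x_n)_{n\in\mathbb N}\subset E$ and $x\in E$ be such that $(x_n)$ polarly converges to $x$. Then for all $y\in E$ $$d^2(x_n,y)\ \ge\ d^2(x,y)+d^2(x_n,x)+o(1)\qquad (n\to\infty).$$
   Context: (PI): A metric space $(E,d)$ satisfies the parallelogram inequality if for any $x,y\in E$ there exists $m\in E$ such that for every $z\in E$ $$d^2(z,m)\le \tfrac12\big(d^2(z,x)+d^2(z,y)\big)-\tfrac14 d^2(x,y).$$ For $X\subset E$, $\mathrm{rad}(X)=\inf_{u\in E}\sup_{v\in X}d(u,v)$ is the Chebyshev radius. A sequence $(x_n)_{n\in\mathbb N}$ in $E$ polarly converges to $x\in E$ if for every $y\in E$ with $y\neq x$ there exists $M(y)\in\mathbb N$ such that $d(x_n,x)<d(x_n,y)$ for all $n\ge M(y)$. $d^2(u,v)$ means $(d(u,v))^2$, and $o(1)$ denotes a sequence of real numbers (possibly depending on $y$) converging to $0$. *)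

theory Defs
  imports "HOL-Analysis.Analysis"
begin

text \<open>Throughout, a metric space is given by a carrier set \<open>E\<close> and a distance function \<open>d\<close>,
  as in the library locale \<open>Metric_space\<close>.\<close>

definition parallelogram_inequality :: "'a set \<Rightarrow> ('a \<Rightarrow> 'a \<Rightarrow> real) \<Rightarrow> bool" where
  "parallelogram_inequality E d \<longleftrightarrow>
    (\<forall>x\<in>E. \<forall>y\<in>E. \<exists>m\<in>E. \<forall>z\<in>E.
      (d z m)\<^sup>2 \<le> 1/2 * ((d z x)\<^sup>2 + (d z y)\<^sup>2) - 1/4 * (d x y)\<^sup>2)"

text \<open>The radius takes values in the extended nonnegative reals, so that the infimum and the
  supremum exist for every \<open>X\<close>, bounded or not.\<close>

definition chebyshev_radius :: "'a set \<Rightarrow> ('a \<Rightarrow> 'a \<Rightarrow> real) \<Rightarrow> 'a set \<Rightarrow> ennreal" where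
  "chebyshev_radius E d X = (INF u\<in>E. SUP v\<in>X. ennreal (d u v))"

definition polarly_converges ::
    "'a set \<Rightarrow> ('a \<Rightarrow> 'a \<Rightarrow> real) \<Rightarrow> (nat \<Rightarrow> 'a) \<Rightarrow> 'a \<Rightarrow> bool" where
  "polarly_converges E d xs x \<longleftrightarrow>
    (\<forall>y\<in>E. y \<noteq> x \<longrightarrow> (\<exists>M. \<forall>n\<ge>M. d (xs n) x < d (xs n) y))"

end

theory Submission
  imports Defs
begin

text \<open>Iterating (PI) towards \<open>x\<close> gives points \<open>m\<close> with \<open>d x m = t * d x y\<close>, \<open>t = 1/2^k\<close>, at which
  the squared distance satisfies the Euclidean convexity estimate (Stewart's theorem as an inequality).
  Polar convergence yields \<open>d (xs n) x < d (xs n) m\<close> for large \<open>n\<close>; cancelling and dividing by \<open>t\<close>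
  leaves \<open>(d (xs n) y)\<^sup>2 \<ge> (d (xs n) x)\<^sup>2 + (1 - t) * (d x y)\<^sup>2\<close>, where \<open>t\<close> is arbitrarily small.\<close>

text \<open>Testing (PI) at \<open>z = x\<close> and at \<open>z = y\<close> bounds both distances
  to \<open>m\<close> by half of \<open>d x y\<close>; the triangle inequality then leaves no
  slack.\<close>

lemma (in Metric_space) parallelogram_midpoint:
  assumes PI: "parallelogram_inequality M d" and x: "x \<in> M" and y: "y \<in> M"
  obtains m where "m \<in> M" "d x m = d x y / 2"
    "\<And>z. z \<in> M \<Longrightarrow> (d z m)\<^sup>2 \<le> 1/2 * ((d z x)\<^sup>2 + (d z y)\<^sup>2) - 1/4 * (d x y)\<^sup>2"
proof -
  obtain m where m: "m \<in> M"
    and le: "\<And>z. z \<in> M \<Longrightarrow> (d z m)\<^sup>2 \<le> 1/2 * ((d z x)\<^sup>2 + (d z y)\<^sup>2) - 1/4 * (d x y)\<^sup>2"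
    using PI x y unfolding parallelogram_inequality_def by blast
  have "(d x m)\<^sup>2 \<le> (d x y / 2)\<^sup>2"
    using le[OF x] x by (simp add: power_divide)
  then have xm: "d x m \<le> d x y / 2"
    by (rule power2_le_imp_le) simp
  have "(d y m)\<^sup>2 \<le> (d x y / 2)\<^sup>2"
    using le[OF y] y by (simp add: power_divide commute)
  then have "d y m \<le> d x y / 2"
    by (rule power2_le_imp_le) simp
  moreover have "d x y \<le> d x m + d y m"
    using triangle[OF x m y] by (simp add: commute)
  ultimately have "d x m = d x y / 2"
    using xm by linarith
  with m le show thesis
    using that by blast
qed

text \<open>Each step takes the midpoint of \<open>x\<close> and the previous point, which halves
  the parameter \<open>t k\<close>.\<close>

lemma (in Metric_space) parallelogram_dyadic_point:
  assumes PI: "parallelogram_inequality M d" and x: "x \<in> M" and y: "y \<in> M"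
  defines "t \<equiv> \<lambda>k. (1/2 :: real) ^ k"
  shows "\<exists>m\<in>M. d x m = t k * d x y \<and>
    (\<forall>z\<in>M. (d z m)\<^sup>2 \<le> (1 - t k) * (d z x)\<^sup>2 + t k * (d z y)\<^sup>2 - t k * (1 - t k) * (d x y)\<^sup>2)"
proof (induction k)
  case 0
  show ?case using y by (auto simp: t_def)
next
  case (Suc k)
  then obtain p where p: "p \<in> M" "d x p = t k * d x y"
    and p_le: "\<And>z. z \<in> M \<Longrightarrow>
      (d z p)\<^sup>2 \<le> (1 - t k) * (d z x)\<^sup>2 + t k * (d z y)\<^sup>2 - t k * (1 - t k) * (d x y)\<^sup>2"
    by blast
  obtain m where m: "m \<in> M" "d x m = d x p / 2"
    and m_le: "\<And>z. z \<in> M \<Longrightarrow> (d z m)\<^sup>2 \<le> 1/2 * ((d z x)\<^sup>2 + (d z p)\<^sup>2) - 1/4 * (d x p)\<^sup>2"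
    using parallelogram_midpoint[OF PI x p(1)] by blast
  have t_Suc: "t (Suc k) = t k / 2"
    by (simp add: t_def)
  \<comment> \<open>Inserting the bound for \<open>p\<close> into the one for \<open>m\<close>, the
    coefficients of \<open>(d x y)\<^sup>2\<close> combine by
    \<open>t * (1 - t) / 2 + t\<^sup>2 / 4 = (t / 2) * (1 - t / 2)\<close>, with \<open>t\<close>
    short for \<open>t k\<close>.\<close>
  have "(d z m)\<^sup>2 \<le> (1 - t (Suc k)) * (d z x)\<^sup>2 + t (Suc k) * (d z y)\<^sup>2
      - t (Suc k) * (1 - t (Suc k)) * (d x y)\<^sup>2" if "z \<in> M" for z
    using m_le[OF that] p_le[OF that] unfolding p(2) t_Suc
    by (simp add: field_simps power2_eq_square)
  moreover have "d x m = t (Suc k) * d x y"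
    unfolding m(2) p(2) t_Suc by simp
  ultimately show ?case
    using m(1) by blast
qed

text \<open>The epsilon form of the asymptotic inequality. The dyadic level is fixed from
  \<open>e\<close> first, because the threshold supplied by polar convergence depends on the
  comparison point \<open>m\<close>.\<close>

lemma (in Metric_space) polarly_converges_eventually_ge:
  assumes PI: "parallelogram_inequality M d" and xs: "\<And>n. xs n \<in> M" and x: "x \<in> M"
    and polar: "polarly_converges M d xs x" and y: "y \<in> M" and e: "e > 0"
  shows "\<forall>\<^sub>F n in sequentially. (d (xs n) y)\<^sup>2 \<ge> (d x y)\<^sup>2 + (d (xs n) x)\<^sup>2 - e"
proof (cases "y = x")
  case True
  then show ?thesis using x e by simp
next
  case False
  have "(\<lambda>k. (1/2) ^ k * (d x y)\<^sup>2) \<longlonglongrightarrow> 0 * (d x y)\<^sup>2"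
    by (intro tendsto_intros LIMSEQ_power_zero) auto
  then have "\<forall>\<^sub>F k in sequentially. (1/2) ^ k * (d x y)\<^sup>2 < e"
    using e by (intro order_tendstoD) auto
  then obtain k where k: "(1/2) ^ k * (d x y)\<^sup>2 < e"
    by (metis eventually_happens sequentially_bot)
  define t :: real where "t = (1/2) ^ k"
  have t: "t > 0" "t * (d x y)\<^sup>2 < e"
    using k by (auto simp: t_def)
  obtain m where m: "m \<in> M" "d x m = t * d x y"
    and le: "\<And>z. z \<in> M \<Longrightarrow> (d z m)\<^sup>2 \<le> (1 - t) * (d z x)\<^sup>2 + t * (d z y)\<^sup>2 - t * (1 - t) * (d x y)\<^sup>2"
    using parallelogram_dyadic_point[OF PI x y, of k] unfolding t_def by blast
  \<comment> \<open>Since \<open>y\<close> differs from \<open>x\<close>,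
    \<open>d x m = t * d x y\<close> is positive, so polar convergence applies to
    \<open>m\<close>.\<close>
  have "m \<noteq> x"
    using m t False x y by auto
  then obtain N where N: "\<And>n. n \<ge> N \<Longrightarrow> d (xs n) x < d (xs n) m"
    using polar m unfolding polarly_converges_def by blast
  show ?thesis
  proof (rule eventually_sequentiallyI[of N])
    fix n assume "N \<le> n"
    then have "(d (xs n) x)\<^sup>2 \<le> (d (xs n) m)\<^sup>2"
      using N[of n] by (intro power_mono) auto
    then have "(d (xs n) x)\<^sup>2
        \<le> (1 - t) * (d (xs n) x)\<^sup>2 + t * (d (xs n) y)\<^sup>2 - t * (1 - t) * (d x y)\<^sup>2"
      using le[OF xs, of n] by (rule order_trans)
    then have "t * ((d x y)\<^sup>2 + (d (xs n) x)\<^sup>2 - t * (d x y)\<^sup>2) \<le> t * (d (xs n) y)\<^sup>2"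
      by (simp add: algebra_simps)
    then have "(d x y)\<^sup>2 + (d (xs n) x)\<^sup>2 - t * (d x y)\<^sup>2 \<le> (d (xs n) y)\<^sup>2"
      using t(1) by simp
    then show "(d x y)\<^sup>2 + (d (xs n) x)\<^sup>2 - e \<le> (d (xs n) y)\<^sup>2"
      using t(2) by linarith
  qed
qed

theorem theorem8p6:
  fixes E :: "'a set" and d :: "'a \<Rightarrow> 'a \<Rightarrow> real" and xs :: "nat \<Rightarrow> 'a" and x :: 'a
  assumes "Metric_space E d"
    and "parallelogram_inequality E d"
    and "\<forall>a\<in>E. \<forall>b\<in>E. ennreal (d a b) = 2 * chebyshev_radius E d {a, b}"
    and "\<forall>n. xs n \<in> E"
    and "x \<in> E"
    and "polarly_converges E d xs x"
  shows "\<forall>y\<in>E. \<exists>r :: nat \<Rightarrow> real. r \<longlonglongrightarrow> 0 \<and>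
    (\<forall>n. (d (xs n) y)\<^sup>2 \<ge> (d x y)\<^sup>2 + (d (xs n) x)\<^sup>2 + r n)"
proof
  fix y assume y: "y \<in> E"
  interpret Metric_space E d by fact
  \<comment> \<open>Only the negative part of the defect is kept: the defect itself may stay
    positive and need not tend to 0.\<close>
  define r where "r = (\<lambda>n. min 0 ((d (xs n) y)\<^sup>2 - (d x y)\<^sup>2 - (d (xs n) x)\<^sup>2))"
  have "\<forall>\<^sub>F n in sequentially. dist (r n) 0 < e" if "e > 0" for e
  proof -
    \<comment> \<open>\<open>e / 2\<close> turns the weak lower bound into the strict
      \<open>dist (r n) 0 < e\<close>.\<close>
    have "\<forall>\<^sub>F n in sequentially. (d (xs n) y)\<^sup>2 \<ge> (d x y)\<^sup>2 + (d (xs n) x)\<^sup>2 - e / 2"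
      using assms y that by (intro polarly_converges_eventually_ge) auto
    then show ?thesis
      by eventually_elim (use that in \<open>auto simp: r_def dist_real_def min_def\<close>)
  qed
  then have "r \<longlonglongrightarrow> 0"
    by (rule tendstoI)
  moreover have "(d x y)\<^sup>2 + (d (xs n) x)\<^sup>2 + r n \<le> (d (xs n) y)\<^sup>2" for n
    by (simp add: r_def)
  ultimately show "\<exists>r :: nat \<Rightarrow> real. r \<longlonglongrightarrow> 0 \<and>
      (\<forall>n. (d (xs n) y)\<^sup>2 \<ge> (d x y)\<^sup>2 + (d (xs n) x)\<^sup>2 + r n)"
    by blast
qed

end
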